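(* Let $k$ be a non-negative integer and let $G$ be a finite oriented graph with the following property: for every block $B$ of the underlying graph of $G$, every vertex of $G[B]$ has indegree at most $k$ and outdegree at most $k$ in $G[B]$. Then $\overrightarrow{\lambda}_{2,1}(G)\leq 2k^2+6k$.
   Context: An oriented graph is a directed graph whose underlying undirected graph is simple (no loops, no multiple edges, and no pair of opposite arcs). A block of an undirected graph is a maximal biconnected subgraph (as usual, a bridge together with its endpoints, or an isolated vertex, counts as a block); $G[B]$ denotes the sub-oriented-graph of $G$ induced by the vertices of $B$. An $L(2,1)$-labeling of an oriented graph $G$ is a function $f:V(G)\to\{0,\dots,m\}$, for some integer $m \ge 0$, such that $|f(u)-f(v)|\geq 2$ whenever $u$ and $v$ are adjacent (joined by an arc in either direction), and $|f(u)-f(v)|\geq 1$ whenever $u\neq v$ are joined by a directed path of length two (that is, there is a vertex $w$ with $u\to w\to v$ or $v\to w\to u$). The number $\overrightarrow{\lambda}_{2,1}(G)$ is the minimum $m$ for which such a labeling exists. *)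

theory Defs
  imports "Graph_Theory.Digraph_Component"
begin

locale oriented_graph = loopfree_digraph + nomulti_digraph +
  assumes no_opposite_arcs: "u \<rightarrow>\<^bsub>G\<^esub> v \<Longrightarrow> \<not> v \<rightarrow>\<^bsub>G\<^esub> u"

text \<open>
  As in the rest of the library, undirected graphs are symmetric digraphs
  (locale \<^locale>\<open>graph\<close>).
\<close>

definition underlying_graph :: "('a, 'b) pre_digraph \<Rightarrow> ('a, 'a \<times> 'a) pre_digraph" where
  "underlying_graph G = with_proj (mk_symmetric G)"

text \<open>
  The null graph does not satisfy \<^const>\<open>connected\<close>, hence the condition
  \<^prop>\<open>verts H \<noteq> {v}\<close>. The graphs on one vertex and the connected graphs on two
  vertices are biconnected, so that isolated vertices and bridges form blocks.
\<close>

definition biconnected :: "('a, 'b) pre_digraph \<Rightarrow> bool" where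
  "biconnected H \<longleftrightarrow> graph H \<and> connected H \<and>
     (\<forall>v \<in> verts H. verts H \<noteq> {v} \<longrightarrow> connected (pre_digraph.del_vert H v))"

definition is_block :: "('a, 'b) pre_digraph \<Rightarrow> ('a, 'b) pre_digraph \<Rightarrow> bool" where
  "is_block U B \<longleftrightarrow> pre_digraph.max_subgraph U biconnected B"

definition L21_labeling :: "('a, 'b) pre_digraph \<Rightarrow> nat \<Rightarrow> ('a \<Rightarrow> nat) \<Rightarrow> bool" where
  "L21_labeling G m f \<longleftrightarrow>
     (\<forall>v \<in> verts G. f v \<in> {0..m}) \<and>
     (\<forall>u \<in> verts G. \<forall>v \<in> verts G.
        u \<rightarrow>\<^bsub>G\<^esub> v \<or> v \<rightarrow>\<^bsub>G\<^esub> u \<longrightarrow> \<bar>int (f u) - int (f v)\<bar> \<ge> 2) \<and>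
     (\<forall>u \<in> verts G. \<forall>v \<in> verts G.
        u \<noteq> v \<and> (\<exists>w \<in> verts G. (u \<rightarrow>\<^bsub>G\<^esub> w \<and> w \<rightarrow>\<^bsub>G\<^esub> v) \<or> (v \<rightarrow>\<^bsub>G\<^esub> w \<and> w \<rightarrow>\<^bsub>G\<^esub> u))
        \<longrightarrow> \<bar>int (f u) - int (f v)\<bar> \<ge> 1)"

definition lambda21 :: "('a, 'b) pre_digraph \<Rightarrow> nat" where
  "lambda21 G = (LEAST m. \<exists>f. L21_labeling G m f)"

text \<open>The minimum is over a nonempty set: number the vertices by distinct even labels.\<close>

lemma L21_labeling_exists:
  assumes "fin_digraph G" "loopfree_digraph G"
  shows "\<exists>m f. L21_labeling G m f"
proof -
  interpret fin_digraph G by fact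
  interpret loopfree_digraph G by fact
  obtain g :: "'a \<Rightarrow> nat" where g: "inj_on g (verts G)"
    using finite_imp_inj_to_nat_seg[OF finite_verts] by blast
  have far: "\<bar>int (2 * g u) - int (2 * g v)\<bar> \<ge> 2"
    if "u \<in> verts G" "v \<in> verts G" "u \<noteq> v" for u v
    using inj_onD[OF g _ that(1,2)] that(3) by fastforce
  have le: "2 * g v \<le> (\<Sum>x \<in> verts G. 2 * g x)" if "v \<in> verts G" for v
    using that by (intro member_le_sum) auto
  have "L21_labeling G (\<Sum>x \<in> verts G. 2 * g x) (\<lambda>v. 2 * g v)"
    unfolding L21_labeling_def
    using far le by (fastforce dest: adj_not_same)
  then show ?thesis by blast
qed

lemma L21_labeling_lambda21:
  assumes "fin_digraph G" "loopfree_digraph G"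
  shows "\<exists>f. L21_labeling G (lambda21 G) f"
  unfolding lambda21_def by (rule LeastI_ex[OF L21_labeling_exists[OF assms]])

end

(*
Reserve at every vertex u, besides its label, two disjoint sets of labels, one for the
in-neighbours and one for the out-neighbours of u, at distance at least 2 from the label of u.
If all arcs respect these reservations, then the labeling is an L(2,1)-labeling, and two such
labelings that agree (with their reservations) at a single common vertex can be glued there, no
matter how many blocks meet at that vertex. So it suffices to extend prescribed data at one vertex
v to a set of vertices that has no separation by at most one vertex; such a set lies in a block.
Of the 2k^2+6k+1 labels at most 3 are too close to the label of v, which leaves room for two
reserved sets of size k^2+3k-1. Greedily label the neighbours of v from these sets, then all other
vertices: each has at most 2k neighbours and 2k^2 vertices at directed distance two, which exclude
at most 6k+2k^2 labels.
*)

theory Submission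
  imports Defs
begin

section \<open>Counting excluded labels\<close>

definition far :: "nat \<Rightarrow> nat \<Rightarrow> bool" where
  "far a b \<longleftrightarrow> a + 2 \<le> b \<or> b + 2 \<le> a"

lemma far_sym: "far a b \<Longrightarrow> far b a"
  by (auto simp: far_def)

text \<open>
  Each element of \<open>A\<close> excludes three labels. An element of \<open>B\<close> excludes only two labels of \<open>L\<close>,
  since its own label lies outside \<open>L\<close>.
\<close>

lemma exists_far_label:
  fixes f :: "'a \<Rightarrow> nat"
  assumes fin: "finite A" "finite B" "finite C"
    and card: "3 * card A + 2 * card B + card C < card L"
    and B: "\<And>w. w \<in> B \<Longrightarrow> f w \<notin> L"
  shows "\<exists>x\<in>L. (\<forall>w\<in>A \<union> B. far x (f w)) \<and> (\<forall>w\<in>C. x \<noteq> f w)"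
proof -
  \<comment> \<open>For \<open>f w = 0\<close> the truncated \<open>f w - 1\<close> is
    \<open>f w\<close> itself. Excluding it is harmless: in \<open>A\<close> this label is excluded
    anyway, and in \<open>B\<close> it lies outside \<open>L\<close>.\<close>
  define F where "F = (\<Union>w\<in>A. {f w - 1, f w, f w + 1}) \<union> (\<Union>w\<in>B. {f w - 1, f w + 1}) \<union> f ` C"
  have "card (\<Union>w\<in>A. {f w - 1, f w, f w + 1}) \<le> (\<Sum>w\<in>A. card {f w - 1, f w, f w + 1})"
    by (rule card_UN_le[OF fin(1)])
  also have "\<dots> \<le> of_nat (card A) * 3"
    by (rule sum_bounded_above) (simp add: card_insert_if)
  finally have 1: "card (\<Union>w\<in>A. {f w - 1, f w, f w + 1}) \<le> 3 * card A"
    by simp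
  have "card (\<Union>w\<in>B. {f w - 1, f w + 1}) \<le> (\<Sum>w\<in>B. card {f w - 1, f w + 1})"
    by (rule card_UN_le[OF fin(2)])
  also have "\<dots> \<le> of_nat (card B) * 2"
    by (rule sum_bounded_above) (simp add: card_insert_if)
  finally have 2: "card (\<Union>w\<in>B. {f w - 1, f w + 1}) \<le> 2 * card B"
    by simp
  have 3: "card (f ` C) \<le> card C"
    by (rule card_image_le[OF fin(3)])
  have "card F \<le> 3 * card A + 2 * card B + card C"
    unfolding F_def by (intro order_trans[OF card_Un_le] add_mono 1 2 3)
  moreover have "finite F"
    unfolding F_def using fin by auto
  ultimately have "\<not> L \<subseteq> F"
    using card card_mono[of F L] by linarith
  then obtain x where x: "x \<in> L" "x \<notin> F"
    by blast
  have "far x (f w)" if "w \<in> A" for w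
  proof -
    have "x \<noteq> f w - 1" "x \<noteq> f w" "x \<noteq> f w + 1"
      using x(2) that unfolding F_def by blast+
    then show ?thesis by (simp add: far_def) linarith
  qed
  moreover have "far x (f w)" if "w \<in> B" for w
  proof -
    have "x \<noteq> f w - 1" "x \<noteq> f w + 1"
      using x(2) that unfolding F_def by blast+
    moreover have "x \<noteq> f w"
      using B[OF that] x(1) by auto
    ultimately show ?thesis by (simp add: far_def) linarith
  qed
  moreover have "x \<noteq> f w" if "w \<in> C" for w
    using x(2) that unfolding F_def by blast
  ultimately show ?thesis
    using x(1) by blast
qed

text \<open>Fill \<open>A\<close> up to exactly \<open>s\<close> elements inside
  \<open>T - B\<close>; then all of \<open>T - A'\<close> can serve as \<open>B'\<close>.\<close>

lemma disjoint_extensions: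
  assumes "finite T" "A \<subseteq> T" "B \<subseteq> T" "A \<inter> B = {}"
    and "card A \<le> s" "card B \<le> s" "2 * s \<le> card T"
  obtains A' B' where "A \<subseteq> A'" "B \<subseteq> B'" "A' \<subseteq> T" "B' \<subseteq> T" "A' \<inter> B' = {}"
    "s \<le> card A'" "s \<le> card B'"
proof -
  have fin: "finite A" "finite B"
    using assms(1-3) finite_subset by blast+
  have "card (T - B) = card T - card B"
    using fin assms by (simp add: card_Diff_subset)
  then have "s \<le> card (T - B)"
    using assms by linarith
  moreover have "A \<subseteq> T - B"
    using assms by blast
  ultimately obtain A' where A': "A \<subseteq> A'" "A' \<subseteq> T - B" "card A' = s"
    using exists_subset_between[of A s "T - B"] assms by auto
  have "card (T - A') = card T - card A'"
    using A'(2) assms(1) by (intro card_Diff_subset) (auto intro: finite_subset)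
  then show thesis
    using A' assms by (intro that[of A' "T - A'"]) auto
qed

section \<open>Reserved labels and separations\<close>

text \<open>
  \<open>P\<close> and \<open>Q\<close> are the labels reserved for the in-neighbours and for the out-neighbours of a vertex
  with label \<open>a\<close>.
\<close>

definition admissible :: "nat \<Rightarrow> nat \<Rightarrow> nat \<Rightarrow> nat set \<Rightarrow> nat set \<Rightarrow> bool" where
  "admissible m s a P Q \<longleftrightarrow> a \<le> m \<and> P \<subseteq> {..m} \<and> Q \<subseteq> {..m} \<and> P \<inter> Q = {} \<and>
     (\<forall>b\<in>P \<union> Q. far a b) \<and> s \<le> card P \<and> s \<le> card Q"

text \<open>\<open>R u w\<close> stands for an arc from \<open>u\<close> to \<open>w\<close>. Each
  condition concerns one vertex or one arc, so it survives gluing; distance two is handled by the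
  disjointness of \<open>I z\<close> and \<open>J z\<close> at the middle vertex
  \<open>z\<close>.\<close>

definition in_out_labeling ::
  "nat \<Rightarrow> nat \<Rightarrow> ('a \<Rightarrow> 'a \<Rightarrow> bool) \<Rightarrow> 'a set \<Rightarrow>
    ('a \<Rightarrow> nat) \<Rightarrow> ('a \<Rightarrow> nat set) \<Rightarrow> ('a \<Rightarrow> nat set) \<Rightarrow> bool" where
  "in_out_labeling m s R X f I J \<longleftrightarrow>
     (\<forall>u\<in>X. admissible m s (f u) (I u) (J u)) \<and>
     (\<forall>u\<in>X. \<forall>w\<in>X. R u w \<longrightarrow> f w \<in> J u \<and> f u \<in> I w)"

text \<open>
  A separation may have \<open>A \<inter> B = {}\<close>, so nonseparable sets are in particular connected.
\<close>

definition nonseparable :: "('a \<Rightarrow> 'a \<Rightarrow> bool) \<Rightarrow> 'a set \<Rightarrow> bool" where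
  "nonseparable R X \<longleftrightarrow>
     (\<forall>A B c. A \<union> B = X \<and> A \<inter> B \<subseteq> {c} \<and> (\<forall>x\<in>A - B. \<forall>y\<in>B - A. \<not> R x y \<and> \<not> R y x)
        \<longrightarrow> A = X \<or> B = X)"

lemma nonseparableD:
  assumes "nonseparable R X" "A \<union> B = X" "A \<inter> B \<subseteq> {c}"
    and "\<And>x y. x \<in> A - B \<Longrightarrow> y \<in> B - A \<Longrightarrow> \<not> R x y \<and> \<not> R y x"
  shows "A = X \<or> B = X"
proof -
  have "\<forall>x\<in>A - B. \<forall>y\<in>B - A. \<not> R x y \<and> \<not> R y x"
    using assms(4) by blast
  then show ?thesis
    using assms(1)[unfolded nonseparable_def, THEN spec[of _ A], THEN spec[of _ B], THEN spec[of _ c]]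
      assms(2,3) by blast
qed

text \<open>Only \<open>a - 1\<close>, \<open>a\<close> and \<open>a + 1\<close> are too close to
  \<open>a\<close>, so at least \<open>m + 1 - 3 \<ge> 2 * s\<close> labels remain to be shared
  out.\<close>

lemma admissible_extension:
  assumes "a \<le> m" "2 * s + 2 \<le> m"
    and "A \<subseteq> {..m}" "B \<subseteq> {..m}" "A \<inter> B = {}" "\<And>b. b \<in> A \<union> B \<Longrightarrow> far a b"
    and "card A \<le> s" "card B \<le> s"
  shows "\<exists>P Q. A \<subseteq> P \<and> B \<subseteq> Q \<and> admissible m s a P Q"
proof -
  define T where "T = {..m} - {a - 1, a, a + 1}"
  have far_iff: "far a b \<longleftrightarrow> b \<notin> {a - 1, a, a + 1}" if "b \<le> m" for b
    by (auto simp: far_def)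
  have "card {..m} - card {a - 1, a, a + 1} \<le> card T"
    unfolding T_def by (rule diff_card_le_card_Diff) auto
  moreover have "card {a - 1, a, a + 1} \<le> 3"
    by (simp add: card_insert_if)
  ultimately have "2 * s \<le> card T"
    using assms(2) by simp
  moreover have "finite T" "A \<subseteq> T" "B \<subseteq> T"
    using assms(3,4,6) far_iff unfolding T_def by blast+
  ultimately obtain P Q where "A \<subseteq> P" "B \<subseteq> Q" "P \<subseteq> T" "Q \<subseteq> T" "P \<inter> Q = {}" "s \<le> card P" "s \<le> card Q"
    using disjoint_extensions[of T A B s] assms by metis
  moreover from this have "\<forall>b\<in>P \<union> Q. far a b"
    using far_iff unfolding T_def by blast
  moreover have "P \<subseteq> {..m}" "Q \<subseteq> {..m}"
    using \<open>P \<subseteq> T\<close> \<open>Q \<subseteq> T\<close> unfolding T_def by blast+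
  ultimately show ?thesis
    using assms(1) unfolding admissible_def by blast
qed

section \<open>Greedy labeling under degree bounds\<close>

text \<open>Only the reserved sets at \<open>v\<close> restrict the greedy choice. At the other
  vertices they are chosen once all labels are known, by enlarging the sets of labels that occur on
  the in-neighbours and on the out-neighbours.\<close>

lemma in_out_labeling_bounded_degree:
  fixes R :: "'a \<Rightarrow> 'a \<Rightarrow> bool" and k :: nat
  assumes fin: "finite X" and v: "v \<in> X" and k: "k \<ge> 1"
    and asym: "\<And>u w. R u w \<Longrightarrow> \<not> R w u"
    and deg: "\<And>u. u \<in> X \<Longrightarrow> card {w \<in> X. R w u} \<le> k \<and> card {w \<in> X. R u w} \<le> k"
    and adm: "admissible (2 * k^2 + 6 * k) (k^2 + 3 * k - 1) a P Q"
  shows "\<exists>f I J. in_out_labeling (2 * k^2 + 6 * k) (k^2 + 3 * k - 1) R X f I J \<and>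
           f v = a \<and> I v = P \<and> J v = Q"
proof -
  let ?m = "2 * k^2 + 6 * k" and ?s = "k^2 + 3 * k - 1"
  define Ni where "Ni u = {w \<in> X. R w u}" for u
  define No where "No u = {w \<in> X. R u w}" for u
  define D where "D u = {w \<in> X. w \<noteq> u \<and> (\<exists>z\<in>X. R u z \<and> R z w \<or> R w z \<and> R z u)}" for u
  have finN: "finite (Ni u)" "finite (No u)" "finite (D u)" for u
    using fin by (auto simp: Ni_def No_def D_def)
  have degN: "card (Ni u) \<le> k" "card (No u) \<le> k" if "u \<in> X" for u
    using deg[OF that] by (auto simp: Ni_def No_def)
  have irr: "\<not> R u u" for u
    using asym by blast
  have D_sym: "u \<in> D w" if "w \<in> D u" "u \<in> X" for u w
    using that by (auto simp: D_def)
  have cardD: "card (D u) \<le> 2 * k^2" if u: "u \<in> X" for u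
  proof -
    have 1: "card (\<Union>z\<in>No u. No z) \<le> k * k"
    proof -
      have "card (\<Union>z\<in>No u. No z) \<le> (\<Sum>z\<in>No u. card (No z))"
        by (rule card_UN_le[OF finN(2)])
      also have "\<dots> \<le> of_nat (card (No u)) * k"
        by (rule sum_bounded_above) (auto intro!: degN simp: No_def[of u])
      also have "\<dots> \<le> k * k"
        using degN[OF u] by simp
      finally show ?thesis .
    qed
    have 2: "card (\<Union>z\<in>Ni u. Ni z) \<le> k * k"
    proof -
      have "card (\<Union>z\<in>Ni u. Ni z) \<le> (\<Sum>z\<in>Ni u. card (Ni z))"
        by (rule card_UN_le[OF finN(1)])
      also have "\<dots> \<le> of_nat (card (Ni u)) * k"
        by (rule sum_bounded_above) (auto intro!: degN simp: Ni_def[of u])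
      also have "\<dots> \<le> k * k"
        using degN[OF u] by simp
      finally show ?thesis .
    qed
    have "D u \<subseteq> (\<Union>z\<in>No u. No z) \<union> (\<Union>z\<in>Ni u. Ni z)"
      unfolding D_def No_def Ni_def by blast
    then have "card (D u) \<le> card ((\<Union>z\<in>No u. No z) \<union> (\<Union>z\<in>Ni u. Ni z))"
      using finN by (intro card_mono) auto
    also have "\<dots> \<le> k * k + k * k"
      by (intro order_trans[OF card_Un_le] add_mono 1 2)
    finally show ?thesis
      by (simp add: power2_eq_square)
  qed
  have adm': "a \<le> ?m" "P \<subseteq> {..?m}" "Q \<subseteq> {..?m}" "P \<inter> Q = {}" "\<And>b. b \<in> P \<union> Q \<Longrightarrow> far a b"
    "?s \<le> card P" "?s \<le> card Q"
    using adm unfolding admissible_def by auto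

  \<comment> \<open>Since \<open>D\<close> takes middle vertices from all of \<open>X\<close> and
    not just from \<open>Y\<close>, labeling a middle vertex later adds no condition on pairs
    already labelled.\<close>
  define proper where "proper Y f \<longleftrightarrow> f v = a \<and>
      (\<forall>u\<in>Y. f u \<le> ?m \<and> (R u v \<longrightarrow> f u \<in> P) \<and> (R v u \<longrightarrow> f u \<in> Q)) \<and>
      (\<forall>u\<in>Y. \<forall>w\<in>Y. (R u w \<longrightarrow> far (f u) (f w)) \<and> (w \<in> D u \<longrightarrow> f u \<noteq> f w))" for Y f
  have extend: "proper (insert u Y) (f(u := x))"
    if "proper Y f" "u \<notin> Y" "u \<noteq> v" "Y \<subseteq> X" "u \<in> X" "x \<le> ?m" "R u v \<Longrightarrow> x \<in> P" "R v u \<Longrightarrow> x \<in> Q"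
      "\<And>w. w \<in> Y \<Longrightarrow> R u w \<or> R w u \<Longrightarrow> far x (f w)" "\<And>w. w \<in> Y \<Longrightarrow> w \<in> D u \<Longrightarrow> x \<noteq> f w"
    for u x Y f
  proof -
    have "far (f w) x" if "w \<in> Y" "R w u" for w
      using far_sym that \<open>\<And>w. w \<in> Y \<Longrightarrow> R u w \<or> R w u \<Longrightarrow> far x (f w)\<close> by blast
    moreover have "f w \<noteq> x" if "w \<in> Y" "u \<in> D w" for w
      using that \<open>\<And>w. w \<in> Y \<Longrightarrow> w \<in> D u \<Longrightarrow> x \<noteq> f w\<close> D_sym \<open>Y \<subseteq> X\<close> by blast
    moreover have "u \<notin> D u"
      by (simp add: D_def)
    ultimately show ?thesis
      using that irr unfolding proper_def by auto
  qed

  \<comment> \<open>The right side exceeds the left by \<open>(k - 1)^2 + 1\<close>.\<close>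
  have small: "3 * (k - 1) + 2 * k < ?s"
  proof -
    obtain j where "k = Suc j"
      using k by (cases k) auto
    then show ?thesis
      by (simp add: power2_eq_square)
  qed
  have nbrs: "\<exists>f. proper (insert v Y) f" if "finite Y" "Y \<subseteq> Ni v \<union> No v" for Y
    \<comment> \<open>The neighbours of \<open>v\<close> go first, because their labels are confined to \<open>P\<close> and \<open>Q\<close>:
      at this stage at most \<open>3 (k - 1) + 2 k\<close> labels are excluded.\<close>
    using that
  proof (induction Y rule: finite_induct)
    case empty
    have "v \<notin> D v"
      by (simp add: D_def)
    then have "proper {v} (\<lambda>_. a)"
      using adm' irr by (simp add: proper_def)
    then show ?case
      by blast
  next
    case (insert u Y)
    then obtain f where f: "proper (insert v Y) f"
      by auto
    have u: "u \<in> X" "u \<noteq> v" "u \<notin> insert v Y" and YX: "insert v Y \<subseteq> X"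
      using insert v irr by (auto simp: Ni_def No_def)
    have YP: "f w \<in> P" if "w \<in> Y \<inter> Ni v" for w
      using f that by (auto simp: proper_def Ni_def)
    have YQ: "f w \<in> Q" if "w \<in> Y \<inter> No v" for w
      using f that by (auto simp: proper_def No_def)
    have fin2: "finite (Y \<inter> No v)" "finite (Y \<inter> Ni v)"
      using insert.hyps by auto
    have Y: "Y \<inter> Ni v \<union> Y \<inter> No v = Y"
      using insert.prems by blast
    \<comment> \<open>Being far from all earlier labels settles adjacency and distance two at once.
      On the side of \<open>u\<close> at most \<open>k - 1\<close> other neighbours of
      \<open>v\<close> exclude three labels each; on the opposite side at most \<open>k\<close>
      exclude two each, their labels lying in the other reserved set.\<close>
    have far_all: "\<exists>x. x \<le> ?m \<and> (R u v \<longrightarrow> x \<in> P) \<and> (R v u \<longrightarrow> x \<in> Q) \<and> (\<forall>w\<in>insert v Y. far x (f w))"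
    proof (cases "R v u")
      case True
      have "card (Y \<inter> No v) \<le> card (No v - {u})"
        using insert.hyps finN by (intro card_mono) auto
      also have "\<dots> = card (No v) - 1"
        using True u finN by (simp add: No_def)
      finally have "card (Y \<inter> No v) \<le> k - 1"
        using degN(2)[OF v] by linarith
      moreover have "card (Y \<inter> Ni v) \<le> k"
        using card_mono[of "Ni v" "Y \<inter> Ni v"] finN degN(1)[OF v] by fastforce
      ultimately have "3 * card (Y \<inter> No v) + 2 * card (Y \<inter> Ni v) + card ({}::'a set) < card Q"
        using small adm'(7) by simp
      then obtain x where "x \<in> Q" "\<forall>w\<in>Y \<inter> No v \<union> Y \<inter> Ni v. far x (f w)"
        using exists_far_label[of "Y \<inter> No v" "Y \<inter> Ni v" "{}" Q f] fin2 YP adm'(4) by blast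
      moreover have "far x (f v)"
        using adm'(5) \<open>x \<in> Q\<close> f far_sym by (auto simp: proper_def)
      ultimately show ?thesis
        using asym True adm' Y by (intro exI[of _ x]) auto
    next
      case False
      then have R: "R u v"
        using insert.prems by (auto simp: Ni_def No_def)
      have "card (Y \<inter> Ni v) \<le> card (Ni v - {u})"
        using insert.hyps finN by (intro card_mono) auto
      also have "\<dots> = card (Ni v) - 1"
        using R u finN by (simp add: Ni_def)
      finally have "card (Y \<inter> Ni v) \<le> k - 1"
        using degN(1)[OF v] by linarith
      moreover have "card (Y \<inter> No v) \<le> k"
        using card_mono[of "No v" "Y \<inter> No v"] finN degN(2)[OF v] by fastforce
      ultimately have "3 * card (Y \<inter> Ni v) + 2 * card (Y \<inter> No v) + card ({}::'a set) < card P"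
        using small adm'(6) by simp
      then obtain x where "x \<in> P" "\<forall>w\<in>Y \<inter> Ni v \<union> Y \<inter> No v. far x (f w)"
        using exists_far_label[of "Y \<inter> Ni v" "Y \<inter> No v" "{}" P f] fin2 YQ adm'(4) by blast
      moreover have "far x (f v)"
        using adm'(5) \<open>x \<in> P\<close> f far_sym by (auto simp: proper_def)
      ultimately show ?thesis
        using False adm' Y by (intro exI[of _ x]) auto
    qed
    then obtain x where x: "x \<le> ?m" "R u v \<Longrightarrow> x \<in> P" "R v u \<Longrightarrow> x \<in> Q" "\<forall>w\<in>insert v Y. far x (f w)"
      by blast
    have "proper (insert u (insert v Y)) (f(u := x))"
      using x by (intro extend[OF f u(3) u(2) YX u(1)]) (auto simp: far_def)
    then show ?case
      by (metis insert_commute)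
  qed

  have rest: "\<exists>f. proper (insert v (Ni v \<union> No v) \<union> Z) f"
    if "finite Z" "Z \<subseteq> X - insert v (Ni v \<union> No v)" for Z
    using that
  proof (induction Z rule: finite_induct)
    case empty
    then show ?case
      using nbrs[of "Ni v \<union> No v"] finN by simp
  next
    case (insert u Z)
    let ?Y = "insert v (Ni v \<union> No v) \<union> Z"
    obtain f where f: "proper ?Y f"
      using insert by auto
    have YX: "?Y \<subseteq> X"
      using insert.prems v by (auto simp: Ni_def No_def)
    have u: "u \<in> X" "u \<noteq> v" "u \<notin> ?Y" "\<not> R u v" "\<not> R v u"
      using insert.hyps insert.prems by (auto simp: Ni_def No_def)
    have "card (Ni u \<union> No u) \<le> 2 * k"
      using card_Un_le[of "Ni u" "No u"] degN[OF u(1)] by linarith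
    \<comment> \<open>All neighbours and all of \<open>D u\<close> are counted, labelled or not. The
      bound \<open>6 * k + 2 * k^2\<close> is exactly one less than \<open>card {..?m}\<close>. As
      \<open>u\<close> is not adjacent to \<open>v\<close>, the sets \<open>P\<close> and
      \<open>Q\<close> impose nothing.\<close>
    then have "3 * card (Ni u \<union> No u) + 2 * card ({}::'a set) + card (D u) < card {..?m}"
      using cardD[OF u(1)] by simp
    then obtain x where "x \<in> {..?m}" "\<forall>w\<in>Ni u \<union> No u. far x (f w)" "\<forall>w\<in>D u. x \<noteq> f w"
      using exists_far_label[of "Ni u \<union> No u" "{}" "D u" "{..?m}" f] finN by auto
    then have "proper (insert u ?Y) (f(u := x))"
      using u YX by (intro extend[OF f u(3) u(2) YX u(1)]) (auto simp: Ni_def No_def)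
    then show ?case
      by (metis Un_insert_right)
  qed

  have "insert v (Ni v \<union> No v) \<union> (X - insert v (Ni v \<union> No v)) = X"
    using v by (auto simp: Ni_def No_def)
  then obtain f where f: "proper X f"
    using rest[of "X - insert v (Ni v \<union> No v)"] fin by auto
  have "\<exists>A B. f ` Ni u \<subseteq> A \<and> f ` No u \<subseteq> B \<and> admissible ?m ?s (f u) A B" if u: "u \<in> X" for u
  proof (rule admissible_extension)
    show "f u \<le> ?m" "f ` Ni u \<subseteq> {..?m}" "f ` No u \<subseteq> {..?m}"
      using f u by (auto simp: proper_def Ni_def No_def)
    \<comment> \<open>Equality holds, since \<open>k \<ge> 1\<close> prevents truncation in
      \<open>?s\<close>: this is the largest size that fits.\<close>
    show "2 * ?s + 2 \<le> ?m"
      using k by simp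
    have "k \<le> ?s"
      using small by simp
    then show "card (f ` Ni u) \<le> ?s" "card (f ` No u) \<le> ?s"
      using degN[OF u] card_image_le[OF finN(1), of f u] card_image_le[OF finN(2), of f u]
      by linarith+
    show "far (f u) b" if "b \<in> f ` Ni u \<union> f ` No u" for b
      using f u that far_sym unfolding proper_def Ni_def No_def by blast
    \<comment> \<open>Here \<open>x\<close>, \<open>u\<close>, \<open>y\<close> form a directed
      path, and \<open>x \<noteq> y\<close> because \<open>R\<close> is asymmetric.\<close>
    have "f x \<noteq> f y" if "x \<in> Ni u" "y \<in> No u" for x y
    proof -
      have "y \<in> D x" "x \<in> X" "y \<in> X"
        using that u asym by (auto simp: Ni_def No_def D_def)
      then show ?thesis
        using f by (auto simp: proper_def)
    qed
    then show "f ` Ni u \<inter> f ` No u = {}"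
      by blast
  qed
  then obtain I J where IJ: "\<And>u. u \<in> X \<Longrightarrow> f ` Ni u \<subseteq> I u \<and> f ` No u \<subseteq> J u \<and> admissible ?m ?s (f u) (I u) (J u)"
    by metis
  have fv: "f v = a"
    using f by (simp add: proper_def)
  have PQ: "f w \<in> P" if "w \<in> X" "R w v" for w
    using f that by (simp add: proper_def)
  have QQ: "f w \<in> Q" if "w \<in> X" "R v w" for w
    using f that by (simp add: proper_def)
  have IJ1: "f w \<in> I u" if "u \<in> X" "w \<in> X" "R w u" for u w
    using IJ[OF that(1)] that by (auto simp: Ni_def)
  have IJ2: "f w \<in> J u" if "u \<in> X" "w \<in> X" "R u w" for u w
    using IJ[OF that(1)] that by (auto simp: No_def)
  \<comment> \<open>The sets chosen at \<open>v\<close> are replaced by the prescribed ones, from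
    which the neighbours of \<open>v\<close> took their labels.\<close>
  have "in_out_labeling ?m ?s R X f (I(v := P)) (J(v := Q))"
    unfolding in_out_labeling_def using IJ IJ1 IJ2 PQ QQ adm fv by auto
  then show ?thesis
    using fv by (intro exI[of _ f] exI[of _ "I(v := P)"] exI[of _ "J(v := Q)"]) auto
qed

section \<open>Gluing along separations\<close>

text \<open>Every arc lies inside \<open>A\<close> or inside \<open>B\<close>, so one of the two
  labelings accounts for it; by agreement on the overlap it does not matter which one is read
  there.\<close>

lemma in_out_labeling_glue:
  assumes 1: "in_out_labeling m s R A f I J" and 2: "in_out_labeling m s R B f' I' J'"
    and agree: "\<And>c. c \<in> A \<inter> B \<Longrightarrow> f' c = f c \<and> I' c = I c \<and> J' c = J c"
    and sep: "\<And>x y. x \<in> A - B \<Longrightarrow> y \<in> B - A \<Longrightarrow> \<not> R x y \<and> \<not> R y x"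
  shows "in_out_labeling m s R (A \<union> B) (\<lambda>u. if u \<in> A then f u else f' u)
           (\<lambda>u. if u \<in> A then I u else I' u) (\<lambda>u. if u \<in> A then J u else J' u)"
    (is "in_out_labeling m s R _ ?f ?I ?J")
proof -
  have inB: "?f u = f' u" "?I u = I' u" "?J u = J' u" if "u \<in> B" for u
    using agree that by auto
  have "?f w \<in> ?J u \<and> ?f u \<in> ?I w" if uw: "u \<in> A \<union> B" "w \<in> A \<union> B" "R u w" for u w
  proof -
    consider "u \<in> A" "w \<in> A" | "u \<in> B" "w \<in> B"
      using sep[of u w] sep[of w u] uw by blast
    then show ?thesis
    proof cases
      case 1
      then show ?thesis
        using assms(1) uw(3) by (simp add: in_out_labeling_def)
    next
      case 2
      then show ?thesis
        unfolding inB[OF 2(1)] inB[OF 2(2)] using assms(2) uw(3) by (simp add: in_out_labeling_def)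
    qed
  qed
  then show ?thesis
    using 1 2 unfolding in_out_labeling_def by auto
qed

text \<open>Induction on \<open>X\<close>; the degree bound passes to subsets because it speaks of
  all nonseparable subsets. If \<open>X\<close> splits, the part containing \<open>v\<close> is
  labelled first, and the other part starts from the data which this gives to a shared
  vertex.\<close>

lemma in_out_labeling_exists:
  fixes R :: "'a \<Rightarrow> 'a \<Rightarrow> bool" and k :: nat
  assumes fin: "finite X" and v: "v \<in> X" and k: "k \<ge> 1"
    and asym: "\<And>u w. R u w \<Longrightarrow> \<not> R w u"
    and deg: "\<And>Y u. Y \<subseteq> X \<Longrightarrow> nonseparable R Y \<Longrightarrow> u \<in> Y \<Longrightarrow>
               card {w \<in> Y. R w u} \<le> k \<and> card {w \<in> Y. R u w} \<le> k"
    and adm: "admissible (2 * k^2 + 6 * k) (k^2 + 3 * k - 1) a P Q"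
  shows "\<exists>f I J. in_out_labeling (2 * k^2 + 6 * k) (k^2 + 3 * k - 1) R X f I J \<and>
           f v = a \<and> I v = P \<and> J v = Q"
  using fin v deg adm
proof (induction X arbitrary: v a P Q rule: finite_psubset_induct)
  case (psubset X)
  let ?m = "2 * k^2 + 6 * k" and ?s = "k^2 + 3 * k - 1"
  show ?case
  proof (cases "nonseparable R X")
    case True
    show ?thesis
      by (rule in_out_labeling_bounded_degree[OF psubset.hyps psubset.prems(1) k])
        (use asym psubset.prems True in blast)+
  next
    case False
    then obtain A0 B0 c0 where AB0: "A0 \<union> B0 = X" "A0 \<inter> B0 \<subseteq> {c0}" "A0 \<noteq> X" "B0 \<noteq> X"
        "\<forall>x\<in>A0 - B0. \<forall>y\<in>B0 - A0. \<not> R x y \<and> \<not> R y x"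
      unfolding nonseparable_def by blast
    have "\<exists>A B. v \<in> A \<and> A \<union> B = X \<and> A \<inter> B \<subseteq> {c0} \<and> A \<noteq> X \<and> B \<noteq> X \<and>
        (\<forall>x\<in>A - B. \<forall>y\<in>B - A. \<not> R x y \<and> \<not> R y x)"
    proof (cases "v \<in> A0")
      case True
      then show ?thesis
        using AB0 by (intro exI[of _ A0] exI[of _ B0]) simp
    next
      case False
      then have "v \<in> B0" "B0 \<union> A0 = X" "B0 \<inter> A0 \<subseteq> {c0}"
        using AB0 psubset.prems(1) by blast+
      then show ?thesis
        using AB0 by (intro exI[of _ B0] exI[of _ A0]) simp
    qed
    then obtain A B where AB: "v \<in> A" "A \<union> B = X" "A \<inter> B \<subseteq> {c0}" "A \<noteq> X" "B \<noteq> X"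
        and sep: "\<And>x y. x \<in> A - B \<Longrightarrow> y \<in> B - A \<Longrightarrow> \<not> R x y \<and> \<not> R y x"
      by blast
    have sub: "A \<subset> X" "B \<subset> X"
      using AB by blast+
    have "\<exists>f I J. in_out_labeling ?m ?s R A f I J \<and> f v = a \<and> I v = P \<and> J v = Q"
      by (rule psubset.IH[OF sub(1) AB(1) _ psubset.prems(3)])
        (use psubset.prems(2) sub in blast)
    then obtain f I J where f: "in_out_labeling ?m ?s R A f I J" "f v = a" "I v = P" "J v = Q"
      by blast
    \<comment> \<open>If the parts are disjoint, any \<open>c\<close> in \<open>B\<close> can start
      with label 0 and any admissible sets. Otherwise \<open>c0\<close> is shared and keeps its data
      from \<open>f\<close>, \<open>I\<close> and \<open>J\<close>.\<close>
    have "\<exists>c\<in>B. \<exists>a' P' Q'. A \<inter> B \<subseteq> {c} \<and> admissible ?m ?s a' P' Q' \<and>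
        (c \<in> A \<longrightarrow> f c = a' \<and> I c = P' \<and> J c = Q')"
    proof (cases "A \<inter> B = {}")
      case True
      then obtain c where c: "c \<in> B"
        using AB by blast
      have "\<exists>P Q. {} \<subseteq> P \<and> {} \<subseteq> Q \<and> admissible ?m ?s 0 P Q"
        by (rule admissible_extension) (use k in auto)
      then show ?thesis
        using True c by blast
    next
      case False
      then have "c0 \<in> A" "c0 \<in> B"
        using AB by blast+
      then show ?thesis
        using AB(3) f(1) unfolding in_out_labeling_def by blast
    qed
    then obtain c a' P' Q' where c: "c \<in> B" "A \<inter> B \<subseteq> {c}" "admissible ?m ?s a' P' Q'"
      "c \<in> A \<longrightarrow> f c = a' \<and> I c = P' \<and> J c = Q'"
      by blast
    have "\<exists>f I J. in_out_labeling ?m ?s R B f I J \<and> f c = a' \<and> I c = P' \<and> J c = Q'"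
      by (rule psubset.IH[OF sub(2) c(1) _ c(3)])
        (use psubset.prems(2) sub in blast)
    then obtain f' I' J' where f': "in_out_labeling ?m ?s R B f' I' J'" "f' c = a'" "I' c = P'" "J' c = Q'"
      by blast
    have agree: "f' x = f x \<and> I' x = I x \<and> J' x = J x" if "x \<in> A \<inter> B" for x
      using that c f' by blast
    show ?thesis
    proof (intro exI conjI)
      show "in_out_labeling ?m ?s R X (\<lambda>u. if u \<in> A then f u else f' u)
          (\<lambda>u. if u \<in> A then I u else I' u) (\<lambda>u. if u \<in> A then J u else J' u)"
        using in_out_labeling_glue[OF f(1) f'(1) agree sep] AB(2) by simp
    qed (use f AB(1) in simp_all)
  qed
qed

section \<open>Nonseparable sets lie in blocks\<close>

text \<open>The cut condition \<open>closed\<close> is applied to the set of vertices reachable from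
  \<open>x\<close>: an edge leaving this set would enlarge it.\<close>

lemma connected_underlying_induce:
  assumes S: "S \<noteq> {}"
    and closed: "\<And>T x. T \<subseteq> S \<Longrightarrow> x \<in> T \<Longrightarrow>
      (\<And>y z. y \<in> T \<Longrightarrow> z \<in> S - T \<Longrightarrow> \<not> y \<rightarrow>\<^bsub>G\<^esub> z \<and> \<not> z \<rightarrow>\<^bsub>G\<^esub> y) \<Longrightarrow> T = S"
  shows "connected (underlying_graph G \<restriction> S)"
proof -
  \<comment> \<open>\<open>connected\<close> symmetrizes its argument once more; \<open>aH\<close>
    shows that the adjacent pairs are still those joined by an arc of \<open>G\<close> within
    \<open>S\<close>.\<close>
  let ?H = "with_proj (mk_symmetric (underlying_graph G \<restriction> S))"
  have vH: "verts ?H = S"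
    by simp
  have aH: "arcs_ends ?H = {(x, y). x \<in> S \<and> y \<in> S \<and> (x \<rightarrow>\<^bsub>G\<^esub> y \<or> y \<rightarrow>\<^bsub>G\<^esub> x)}"
    by (auto simp: underlying_graph_def parcs_mk_symmetric arcs_ends_def arc_to_ends_def image_iff)
  interpret H: wf_digraph ?H
    by unfold_locales (auto simp: underlying_graph_def parcs_mk_symmetric)
  have "x \<rightarrow>\<^sup>*\<^bsub>?H\<^esub> y" if "x \<in> S" "y \<in> S" for x y
  proof -
    have "{y \<in> S. x \<rightarrow>\<^sup>*\<^bsub>?H\<^esub> y} = S"
    proof (rule closed[where x = x])
      show "x \<in> {y \<in> S. x \<rightarrow>\<^sup>*\<^bsub>?H\<^esub> y}"
        using that by (simp add: H.reachable_refl)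
      show "\<not> y \<rightarrow>\<^bsub>G\<^esub> z \<and> \<not> z \<rightarrow>\<^bsub>G\<^esub> y"
        if "y \<in> {y \<in> S. x \<rightarrow>\<^sup>*\<^bsub>?H\<^esub> y}" "z \<in> S - {y \<in> S. x \<rightarrow>\<^sup>*\<^bsub>?H\<^esub> y}" for y z
      proof (rule ccontr)
        assume "\<not> (\<not> y \<rightarrow>\<^bsub>G\<^esub> z \<and> \<not> z \<rightarrow>\<^bsub>G\<^esub> y)"
        then have "(y, z) \<in> arcs_ends ?H"
          unfolding aH using that by blast
        then show False
          using that H.reachable_adj_trans by blast
      qed
    qed auto
    then show ?thesis
      using that by blast
  qed
  then show ?thesis
    unfolding connected_def strongly_connected_def using S vH by auto
qed

lemma graph_underlying_induce:
  assumes "fin_digraph G" "loopfree_digraph G" "S \<subseteq> verts G"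
  shows "graph (underlying_graph G \<restriction> S)"
proof -
  interpret fin_digraph G by fact
  interpret loopfree_digraph G by fact
  have "finite S"
    using assms(3) finite_verts finite_subset by blast
  then show ?thesis
    by unfold_locales
      (auto simp: underlying_graph_def parcs_mk_symmetric arc_to_ends_def arcs_ends_def symmetric_def
        dest: no_loops intro!: symI)
qed

text \<open>A disconnection of \<open>X\<close> is a separation with empty overlap. A disconnection
  of \<open>X - {v}\<close> becomes a separation of \<open>X\<close> when \<open>v\<close> is put on
  both sides.\<close>

lemma biconnected_underlying_induce:
  assumes "fin_digraph G" "loopfree_digraph G" and X: "X \<noteq> {}" "X \<subseteq> verts G"
    and nonsep: "nonseparable (dominates G) X"
  shows "biconnected (underlying_graph G \<restriction> X)"
proof -
  have conn: "connected (underlying_graph G \<restriction> X)"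
  proof (rule connected_underlying_induce[OF X(1)])
    fix T x
    assume T: "T \<subseteq> X" "x \<in> T"
      and sep: "\<And>y z. y \<in> T \<Longrightarrow> z \<in> X - T \<Longrightarrow> \<not> y \<rightarrow>\<^bsub>G\<^esub> z \<and> \<not> z \<rightarrow>\<^bsub>G\<^esub> y"
    have "T \<union> (X - T) = X" "T \<inter> (X - T) \<subseteq> {x}"
      using T by auto
    then have "T = X \<or> X - T = X"
      by (rule nonseparableD[OF nonsep]) (use sep in blast)
    then show "T = X"
      using T by blast
  qed
  have "connected (pre_digraph.del_vert (underlying_graph G \<restriction> X) v)" if v: "v \<in> X" "X \<noteq> {v}" for v
  proof -
    have "connected (underlying_graph G \<restriction> (X - {v}))"
    proof (rule connected_underlying_induce)
      show "X - {v} \<noteq> {}"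
        using v by blast
      fix T x
      assume T: "T \<subseteq> X - {v}" "x \<in> T"
        and sep: "\<And>y z. y \<in> T \<Longrightarrow> z \<in> X - {v} - T \<Longrightarrow> \<not> y \<rightarrow>\<^bsub>G\<^esub> z \<and> \<not> z \<rightarrow>\<^bsub>G\<^esub> y"
      have "insert v T \<union> (X - T) = X" "insert v T \<inter> (X - T) \<subseteq> {v}"
        using T v by auto
      then have "insert v T = X \<or> X - T = X"
        by (rule nonseparableD[OF nonsep]) (use sep v in blast)
      then show "T = X - {v}"
        using T by blast
    qed
    moreover have "pre_digraph.del_vert (underlying_graph G \<restriction> X) v = underlying_graph G \<restriction> (X - {v})"
      by (auto simp: pre_digraph.del_vert_def induce_subgraph_def)
    ultimately show ?thesis
      by simp
  qed
  then show ?thesis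
    using conn graph_underlying_induce[OF assms(1,2) X(2)] unfolding biconnected_def by simp
qed

text \<open>Take a largest subgraph that contains \<open>H\<close> and satisfies \<open>P\<close>.
  Size counts arcs as well as vertices, since a subgraph can grow without gaining vertices.\<close>

lemma (in fin_digraph) max_subgraph_above:
  assumes "subgraph H G" "P H"
  shows "\<exists>M. max_subgraph P M \<and> subgraph H M"
proof -
  define S where "S = {K. subgraph H K \<and> subgraph K G \<and> P K}"
  let ?size = "\<lambda>K. card (verts K) + card (arcs K)"
  have "wf_digraph H"
    using assms(1) by (simp add: subgraph_def)
  then have "H \<in> S"
    using assms by (auto simp: S_def intro: wf_digraph.subgraph_refl)
  moreover have "?size K < Suc (card (verts G) + card (arcs G))" if "K \<in> S" for K
  proof -
    have "verts K \<subseteq> verts G" "arcs K \<subseteq> arcs G"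
      using that by (auto simp: S_def subgraph_def)
    then show ?thesis
      by (simp add: add_mono card_mono less_Suc_eq_le)
  qed
  ultimately obtain M where M: "M \<in> S" "\<And>K. K \<in> S \<Longrightarrow> ?size K \<le> ?size M"
    using ex_has_greatest_nat[of "\<lambda>K. K \<in> S" H ?size] by blast
  have "K = M" if K: "subgraph M K" "subgraph K G" "P K" for K
  proof -
    have "subgraph H K"
      using M(1) K(1) by (auto simp: S_def intro: subgraph_trans)
    then have le: "?size K \<le> ?size M"
      using K M(2) by (simp add: S_def)
    have sub: "verts M \<subseteq> verts K" "arcs M \<subseteq> arcs K" and comp: "compatible K M"
      using K(1) by (auto simp: subgraph_def)
    have fin: "finite (verts K)" "finite (arcs K)"
      using K(2) finite_subset[OF _ finite_verts] finite_subset[OF _ finite_arcs]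
      by (auto simp: subgraph_def)
    have "card (verts M) \<le> card (verts K)" "card (arcs M) \<le> card (arcs K)"
      using sub fin by (auto intro: card_mono)
    then have "card (verts M) = card (verts K)" "card (arcs M) = card (arcs K)"
      using le by linarith+
    then have "verts M = verts K" "arcs M = arcs K"
      using card_subset_eq[OF fin(1) sub(1)] card_subset_eq[OF fin(2) sub(2)] by blast+
    then show ?thesis
      using comp by (simp add: compatible_def)
  qed
  then have "max_subgraph P M"
    using M(1) unfolding max_subgraph_def S_def by blast
  then show ?thesis
    using M(1) by (auto simp: S_def)
qed

lemma nonseparable_subset_block:
  assumes "fin_digraph G" "loopfree_digraph G" and X: "X \<noteq> {}" "X \<subseteq> verts G"
    and "nonseparable (dominates G) X"
  shows "\<exists>B. is_block (underlying_graph G) B \<and> X \<subseteq> verts B"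
proof -
  interpret loopfree_digraph G by fact
  let ?U = "underlying_graph G"
  have "?U \<restriction> verts G = ?U"
    by (rule pre_digraph.equality) (auto simp: underlying_graph_def parcs_mk_symmetric)
  then have "graph ?U"
    using graph_underlying_induce[OF assms(1,2), of "verts G"] by simp
  then interpret U: graph ?U .
  have "subgraph (?U \<restriction> X) ?U"
    using X by (intro U.subgraph_induce_subgraphI) (simp add: underlying_graph_def)
  then obtain B where "is_block ?U B" "subgraph (?U \<restriction> X) B"
    using U.max_subgraph_above[of "?U \<restriction> X" biconnected] biconnected_underlying_induce[OF assms]
    unfolding is_block_def by blast
  then show ?thesis
    using subgraph_imp_subverts by fastforce
qed

text \<open>Distinct neighbours of \<open>u\<close> in \<open>Y\<close> are ends of distinct arcs at
  \<open>u\<close>, and these arcs survive in \<open>G \<restriction> S\<close> because both ends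
  lie in \<open>S\<close>.\<close>

lemma (in fin_digraph) card_dominates_le_degree:
  assumes "Y \<subseteq> S" "u \<in> Y"
  shows "card {w \<in> Y. w \<rightarrow>\<^bsub>G\<^esub> u} \<le> in_degree (G \<restriction> S) u"
    and "card {w \<in> Y. u \<rightarrow>\<^bsub>G\<^esub> w} \<le> out_degree (G \<restriction> S) u"
proof -
  have "finite (arcs (G \<restriction> S))"
    by simp
  then have fin: "finite (in_arcs (G \<restriction> S) u)" "finite (out_arcs (G \<restriction> S) u)"
    by (auto simp: in_arcs_def out_arcs_def)
  have "{w \<in> Y. w \<rightarrow>\<^bsub>G\<^esub> u} \<subseteq> tail G ` in_arcs (G \<restriction> S) u"
    using assms by (auto simp: arcs_ends_def arc_to_ends_def in_arcs_def)
  then show "card {w \<in> Y. w \<rightarrow>\<^bsub>G\<^esub> u} \<le> in_degree (G \<restriction> S) u"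
    unfolding in_degree_def by (rule surj_card_le[OF fin(1)])
  have "{w \<in> Y. u \<rightarrow>\<^bsub>G\<^esub> w} \<subseteq> head G ` out_arcs (G \<restriction> S) u"
    using assms by (auto simp: arcs_ends_def arc_to_ends_def out_arcs_def)
  then show "card {w \<in> Y. u \<rightarrow>\<^bsub>G\<^esub> w} \<le> out_degree (G \<restriction> S) u"
    unfolding out_degree_def by (rule surj_card_le[OF fin(2)])
qed

section \<open>From reservations to the bound\<close>

text \<open>On a directed path from \<open>u\<close> through \<open>z\<close> to \<open>w\<close>,
  the label of \<open>u\<close> lies in \<open>I z\<close> and that of \<open>w\<close> in
  \<open>J z\<close>, and these sets are disjoint.\<close>

lemma in_out_labeling_imp_L21_labeling:
  assumes "in_out_labeling m s (dominates G) (verts G) f I J"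
  shows "L21_labeling G m f"
proof -
  have adm: "f u \<le> m" "I u \<inter> J u = {}" "b \<in> I u \<union> J u \<Longrightarrow> far (f u) b" if "u \<in> verts G" for u b
    using assms that unfolding in_out_labeling_def admissible_def by auto
  have lab: "f w \<in> J u" "f u \<in> I w" if "u \<in> verts G" "w \<in> verts G" "u \<rightarrow>\<^bsub>G\<^esub> w" for u w
    using assms that unfolding in_out_labeling_def by auto
  have far_abs: "\<bar>int a - int b\<bar> \<ge> 2" if "far a b" for a b
    using that by (auto simp: far_def)
  have 1: "\<bar>int (f u) - int (f w)\<bar> \<ge> 2"
    if "u \<in> verts G" "w \<in> verts G" "u \<rightarrow>\<^bsub>G\<^esub> w \<or> w \<rightarrow>\<^bsub>G\<^esub> u" for u w
    using that lab adm(3) by (intro far_abs) blast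
  have "f u \<noteq> f w"
    if "u \<in> verts G" "w \<in> verts G" "z \<in> verts G" "u \<rightarrow>\<^bsub>G\<^esub> z" "z \<rightarrow>\<^bsub>G\<^esub> w" for u w z
    using lab[OF that(1,3,4)] lab[OF that(3,2,5)] adm(2)[OF that(3)] by auto
  then have 2: "f u \<noteq> f w"
    if "u \<in> verts G" "w \<in> verts G" "z \<in> verts G"
      "u \<rightarrow>\<^bsub>G\<^esub> z \<and> z \<rightarrow>\<^bsub>G\<^esub> w \<or> w \<rightarrow>\<^bsub>G\<^esub> z \<and> z \<rightarrow>\<^bsub>G\<^esub> u" for u w z
    using that by metis
  have "\<bar>int (f u) - int (f w)\<bar> \<ge> 1" if "f u \<noteq> f w" for u w
    using that by linarith
  then show ?thesis
    unfolding L21_labeling_def using adm(1) 1 2 by auto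
qed

theorem theorem1:
  fixes k :: nat
    and G :: "('a, 'b) pre_digraph"
  assumes "fin_digraph G"
    and "oriented_graph G"
    and "\<And>B. is_block (underlying_graph G) B \<Longrightarrow>
           \<forall>v \<in> verts (G \<restriction> verts B).
             in_degree (G \<restriction> verts B) v \<le> k \<and> out_degree (G \<restriction> verts B) v \<le> k"
  shows "lambda21 G \<le> 2 * k^2 + 6 * k"
proof -
  interpret fin_digraph G by fact
  interpret oriented_graph G by fact
  have deg: "card {w \<in> Y. w \<rightarrow>\<^bsub>G\<^esub> u} \<le> k \<and> card {w \<in> Y. u \<rightarrow>\<^bsub>G\<^esub> w} \<le> k"
    if Y: "Y \<subseteq> verts G" "nonseparable (dominates G) Y" "u \<in> Y" for Y u
  proof -
    obtain B where "is_block (underlying_graph G) B" "Y \<subseteq> verts B"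
      using nonseparable_subset_block[OF assms(1) loopfree_digraph_axioms _ Y(1,2)] Y(3) by blast
    then show ?thesis
      using assms(3)[of B] card_dominates_le_degree[of Y "verts B" u] Y(3) by fastforce
  qed
  have "\<exists>f. L21_labeling G (2 * k^2 + 6 * k) f"
  \<comment> \<open>For \<open>k = 0\<close> there is no room for reserved labels, but also no arc:
    its two ends would form a nonseparable set with positive outdegree at the tail. So the constant
    label 0 works.\<close>
  proof (cases "k = 0 \<or> verts G = {}")
    case True
    have "\<not> u \<rightarrow>\<^bsub>G\<^esub> w" for u w
    proof
      assume uw: "u \<rightarrow>\<^bsub>G\<^esub> w"
      then have V: "{u, w} \<subseteq> verts G"
        using adj_in_verts by blast
      have "nonseparable (dominates G) {u, w}"
        unfolding nonseparable_def
      proof (intro allI impI, elim conjE)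
        fix A B c
        assume AB: "A \<union> B = {u, w}" "\<forall>x\<in>A - B. \<forall>y\<in>B - A. \<not> x \<rightarrow>\<^bsub>G\<^esub> y \<and> \<not> y \<rightarrow>\<^bsub>G\<^esub> x"
        then show "A = {u, w} \<or> B = {u, w}"
          using uw by blast
      qed
      then have "card {x \<in> {u, w}. u \<rightarrow>\<^bsub>G\<^esub> x} \<le> k"
        using deg[OF V, of u] by blast
      moreover have "card {x \<in> {u, w}. u \<rightarrow>\<^bsub>G\<^esub> x} \<noteq> 0"
        using uw by auto
      ultimately show False
        using True V by auto
    qed
    then have "L21_labeling G (2 * k^2 + 6 * k) (\<lambda>_. 0)"
      by (simp add: L21_labeling_def)
    then show ?thesis
      by blast
  next
    case False
    then obtain v where v: "v \<in> verts G" and k: "k \<ge> 1"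
      by auto
    \<comment> \<open>Nothing is prescribed yet, so an arbitrary vertex \<open>v\<close> starts with
      label 0 and any admissible sets.\<close>
    have "\<exists>P Q. {} \<subseteq> P \<and> {} \<subseteq> Q \<and> admissible (2 * k^2 + 6 * k) (k^2 + 3 * k - 1) 0 P Q"
      by (rule admissible_extension) (use k in auto)
    then obtain P Q where "admissible (2 * k^2 + 6 * k) (k^2 + 3 * k - 1) 0 P Q"
      by blast
    then obtain f I J where
      "in_out_labeling (2 * k^2 + 6 * k) (k^2 + 3 * k - 1) (dominates G) (verts G) f I J"
      using in_out_labeling_exists[OF finite_verts v k, of "dominates G" 0 P Q]
        no_opposite_arcs deg by blast
    then show ?thesis
      using in_out_labeling_imp_L21_labeling by blast
  qed
  then show ?thesis
    unfolding lambda21_def by (blast intro: Least_le)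
qed

end
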